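(* For every focused hypersequent $[p]G$, proof search in $\mathbf{GA_t}$ terminates: there is no infinite sequence $[p]G=H_0,H_1,H_2,\ldots$ of focused hypersequents such that for each $k$, $H_{k+1}$ is a premise of an instance of a rule of $\mathbf{GA_t}$ whose conclusion is $H_k$.
   Context: Formulas are built from propositional variables and $t$ using $+,\to,\land,\lor,\lnot$. A sequent (component) is a pair of finite multisets $\Gamma\vdash\Delta$; a hypersequent a finite multiset of components $\Gamma_1\vdash\Delta_1\mid\ldots\mid\Gamma_n\vdash\Delta_n$. A focused hypersequent $[q]G$ is a hypersequent $G$ together with a propositional variable $q$ (the focus). $m\Gamma$ denotes $m$ copies of $\Gamma$ (multiset union) and $np$ denotes $n$ copies of $p$; "atomic" means consisting of propositional variables. Calculus $\mathbf{GA_t}$ (all rules below keep the same focus $[q]$ in premises and conclusion unless stated): axioms $[q]A\vdash A$ and $[q]\vdash$; (EW) from $[q]G\mid\Gamma\vdash\Delta$ infer $[q]G\mid\Gamma\vdash\Delta\mid\Gamma'\vdash\Delta'$; (M) from $[q]G\mid\Gamma_1\vdash\Delta_1$ and $[q]G\mid\Gamma_2\vdash\Delta_2$ infer $[q]G\mid\Gamma_1,\Gamma_2\vdash\Delta_1,\Delta_2$; the logical rules: $(t,l)$ $\Gamma\vdash\Delta\,/\,\Gamma,t\vdash\Delta$; $(t,r)$ $\Gamma\vdash\Delta\,/\,\Gamma\vdash t,\Delta$; $(\lnot,l)$ $\Gamma\vdash A,\Delta\,/\,\Gamma,\lnot A\vdash\Delta$; $(\lnot,r)$ $\Gamma,A\vdash\Delta\,/\,\Gamma\vdash\lnot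 A,\Delta$; $(\to,l)$ $\Gamma,B\vdash A,\Delta\,/\,\Gamma,A\to B\vdash\Delta$; $(\to,r)$ $\Gamma,A\vdash B,\Delta\,/\,\Gamma\vdash A\to B,\Delta$; $(+,l)$ $\Gamma,A,B\vdash\Delta\,/\,\Gamma,A+B\vdash\Delta$; $(+,r)$ $\Gamma\vdash A,B,\Delta\,/\,\Gamma\vdash A+B,\Delta$; $(\land,l)$ $\Gamma,A\vdash\Delta\mid\Gamma,B\vdash\Delta\,/\,\Gamma,A\land B\vdash\Delta$; $(\land,r)$ two premises $\Gamma\vdash A,\Delta$ and $\Gamma\vdash B,\Delta$ $/\,\Gamma\vdash A\land B,\Delta$; $(\lor,l)$ two premises $\Gamma,A\vdash\Delta$ and $\Gamma,B\vdash\Delta$ $/\,\Gamma,A\lor B\vdash\Delta$; $(\lor,r)$ $\Gamma\vdash A,\Delta\mid\Gamma\vdash B,\Delta\,/\,\Gamma\vdash A\lor B,\Delta$ (each with a side hypersequent $[q]G\mid$ in premises and conclusion); (shift) from $[q]G$ infer $[p]G$, provided $q$ occurs in $G$ and $p$ does not occur in $G$; (S') from $[p]G\mid m\Gamma_1,n\Gamma_2\vdash m\Delta_1,n\Delta_2\mid S$ infer $[p]G\mid\Gamma_1,np\vdash\Delta_1\mid\Gamma_2\vdash\Delta_2,mp$, provided $\Gamma_1,\Gamma_2,\Delta_1,\Delta_2$ are atomic, $n>0$, $m>0$, $p$ does not occur in $\Gamma_1,\Delta_1,\Gamma_2,\Delta_2$, and $S$ is either $\Gamma_1,np\vdash\Delta_1$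 or $\Gamma_2\vdash\Delta_2,mp$.
   Formalization: The sequence is also required to satisfy H_{k+1} ≠ H_k for every k; without this the claim fails, since (M) with Γ_1, Δ_1 empty has its own conclusion [q]G | Γ ⊢ Δ as a premise, so a constant sequence is infinite. *)

theory Defs
  imports "HOL-Library.Multiset"
begin

datatype (vars: 'v) fm =
    Var 'v
  | T
  | Neg "'v fm"
  | Plus "'v fm" "'v fm"
  | Imp "'v fm" "'v fm"
  | And "'v fm" "'v fm"
  | Or "'v fm" "'v fm"

type_synonym 'v sequent = "'v fm multiset \<times> 'v fm multiset"
type_synonym 'v hypersequent = "'v sequent multiset"

(* The first component is the focus; it need not occur in the hypersequent. *)
type_synonym 'v fhypersequent = "'v \<times> 'v hypersequent"

abbreviation seq :: "'v fm multiset \<Rightarrow> 'v fm multiset \<Rightarrow> 'v sequent" (infix "\<turnstile>" 55)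
  where "\<Gamma> \<turnstile> \<Delta> \<equiv> (\<Gamma>, \<Delta>)"

definition vars_mset :: "'v fm multiset \<Rightarrow> 'v set"
  where "vars_mset \<Gamma> = (\<Union>A\<in>set_mset \<Gamma>. vars A)"

definition vars_hyp :: "'v hypersequent \<Rightarrow> 'v set"
  where "vars_hyp G = (\<Union>(\<Gamma>, \<Delta>)\<in>set_mset G. vars_mset \<Gamma> \<union> vars_mset \<Delta>)"

definition atomic :: "'v fm multiset \<Rightarrow> bool"
  where "atomic \<Gamma> \<longleftrightarrow> set_mset \<Gamma> \<subseteq> range Var"

(* GAt Hs H: H follows from the list of premises Hs by one instance of a rule. *)
inductive GAt :: "'v fhypersequent list \<Rightarrow> 'v fhypersequent \<Rightarrow> bool" where
  Ax: "GAt [] (q, {# {#A#} \<turnstile> {#A#} #})"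
| Ax_empty: "GAt [] (q, {# {#} \<turnstile> {#} #})"
| EW: "GAt [(q, G + {# \<Gamma> \<turnstile> \<Delta> #})] (q, G + {# \<Gamma> \<turnstile> \<Delta>, \<Gamma>' \<turnstile> \<Delta>' #})"
| M: "GAt [(q, G + {# \<Gamma>1 \<turnstile> \<Delta>1 #}), (q, G + {# \<Gamma>2 \<turnstile> \<Delta>2 #})]
          (q, G + {# \<Gamma>1 + \<Gamma>2 \<turnstile> \<Delta>1 + \<Delta>2 #})"
| T_l: "GAt [(q, G + {# \<Gamma> \<turnstile> \<Delta> #})] (q, G + {# \<Gamma> + {#T#} \<turnstile> \<Delta> #})"
| T_r: "GAt [(q, G + {# \<Gamma> \<turnstile> \<Delta> #})] (q, G + {# \<Gamma> \<turnstile> {#T#} + \<Delta> #})"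
| Neg_l: "GAt [(q, G + {# \<Gamma> \<turnstile> {#A#} + \<Delta> #})] (q, G + {# \<Gamma> + {#Neg A#} \<turnstile> \<Delta> #})"
| Neg_r: "GAt [(q, G + {# \<Gamma> + {#A#} \<turnstile> \<Delta> #})] (q, G + {# \<Gamma> \<turnstile> {#Neg A#} + \<Delta> #})"
| Imp_l: "GAt [(q, G + {# \<Gamma> + {#B#} \<turnstile> {#A#} + \<Delta> #})] (q, G + {# \<Gamma> + {#Imp A B#} \<turnstile> \<Delta> #})"
| Imp_r: "GAt [(q, G + {# \<Gamma> + {#A#} \<turnstile> {#B#} + \<Delta> #})] (q, G + {# \<Gamma> \<turnstile> {#Imp A B#} + \<Delta> #})"
| Plus_l: "GAt [(q, G + {# \<Gamma> + {#A, B#} \<turnstile> \<Delta> #})] (q, G + {# \<Gamma> + {#Plus A B#} \<turnstile> \<Delta> #})"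
| Plus_r: "GAt [(q, G + {# \<Gamma> \<turnstile> {#A, B#} + \<Delta> #})] (q, G + {# \<Gamma> \<turnstile> {#Plus A B#} + \<Delta> #})"
| And_l: "GAt [(q, G + {# \<Gamma> + {#A#} \<turnstile> \<Delta>, \<Gamma> + {#B#} \<turnstile> \<Delta> #})]
              (q, G + {# \<Gamma> + {#And A B#} \<turnstile> \<Delta> #})"
| And_r: "GAt [(q, G + {# \<Gamma> \<turnstile> {#A#} + \<Delta> #}), (q, G + {# \<Gamma> \<turnstile> {#B#} + \<Delta> #})]
              (q, G + {# \<Gamma> \<turnstile> {#And A B#} + \<Delta> #})"
| Or_l: "GAt [(q, G + {# \<Gamma> + {#A#} \<turnstile> \<Delta> #}), (q, G + {# \<Gamma> + {#B#} \<turnstile> \<Delta> #})]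
             (q, G + {# \<Gamma> + {#Or A B#} \<turnstile> \<Delta> #})"
| Or_r: "GAt [(q, G + {# \<Gamma> \<turnstile> {#A#} + \<Delta>, \<Gamma> \<turnstile> {#B#} + \<Delta> #})]
             (q, G + {# \<Gamma> \<turnstile> {#Or A B#} + \<Delta> #})"
| shift: "GAt [(q, G)] (p, G)" if "q \<in> vars_hyp G" and "p \<notin> vars_hyp G"
| S': "GAt [(p, G + {# repeat_mset m \<Gamma>1 + repeat_mset n \<Gamma>2 \<turnstile> repeat_mset m \<Delta>1 + repeat_mset n \<Delta>2, S #})]
           (p, G + {# \<Gamma>1 + replicate_mset n (Var p) \<turnstile> \<Delta>1, \<Gamma>2 \<turnstile> \<Delta>2 + replicate_mset m (Var p) #})"
  if "atomic \<Gamma>1" and "atomic \<Gamma>2" and "atomic \<Delta>1" and "atomic \<Delta>2"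
    and "n > 0" and "m > 0"
    and "p \<notin> vars_mset \<Gamma>1 \<union> vars_mset \<Delta>1 \<union> vars_mset \<Gamma>2 \<union> vars_mset \<Delta>2"
    and "S = (\<Gamma>1 + replicate_mset n (Var p) \<turnstile> \<Delta>1) \<or> S = (\<Gamma>2 \<turnstile> \<Delta>2 + replicate_mset m (Var p))"

definition premise_of :: "'v fhypersequent \<Rightarrow> 'v fhypersequent \<Rightarrow> bool"
  where "premise_of H' H \<longleftrightarrow> (\<exists>Hs. GAt Hs H \<and> H' \<in> set Hs)"

end

(* Each backward step that changes the hypersequent decreases, lexicographically:
   - the sum over all components of 3^s (s the size) for non-atomic ones and of 1 for atomic ones,
     which drops under (EW) and under every step that decomposes a non-atomic component, as
     2 * 3^(s - 1) < 3^s, and is left unchanged by (shift), (S') and (M) on atomic components;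
   - the number of variables other than the focus, which drops under (shift);
   - the number of components containing the focus, which drops from 2 to 1 in the components
     touched by (S'), however large the combined component becomes;
   - the total size, which drops under a non-trivial (M). *)
theory Submission
  imports Defs
begin

(* The doubling makes the size of A -> B exceed the joint size of A and B by one. *)
definition mset_size :: "'v fm multiset \<Rightarrow> nat"
  where "mset_size \<Gamma> = (\<Sum>A\<in>#\<Gamma>. Suc (2 * size A))"

definition seq_size :: "'v sequent \<Rightarrow> nat"
  where "seq_size s = mset_size (fst s) + mset_size (snd s)"

definition atomic_seq :: "'v sequent \<Rightarrow> bool"
  where "atomic_seq s \<longleftrightarrow> atomic (fst s) \<and> atomic (snd s)"

definition weight :: "'v sequent \<Rightarrow> nat"
  where "weight s = (if atomic_seq s then 1 else 3 ^ seq_size s)"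

definition vars_seq :: "'v sequent \<Rightarrow> 'v set"
  where "vars_seq s = vars_mset (fst s) \<union> vars_mset (snd s)"

definition search_order :: "'v fhypersequent rel"
  where "search_order = measures
    [\<lambda>(p, G). \<Sum>s\<in>#G. weight s,
     \<lambda>(p, G). card (vars_hyp G - {p}),
     \<lambda>(p, G). size {#s \<in># G. p \<in> vars_seq s#},
     \<lambda>(p, G). \<Sum>s\<in>#G. seq_size s]"

lemma mset_size_simps [simp]:
  "mset_size {#} = 0"
  "mset_size (add_mset A \<Gamma>) = Suc (2 * size A) + mset_size \<Gamma>"
  "mset_size (\<Gamma> + \<Delta>) = mset_size \<Gamma> + mset_size \<Delta>"
  by (simp_all add: mset_size_def)

lemma mset_size_eq_0_iff [simp]: "mset_size \<Gamma> = 0 \<longleftrightarrow> \<Gamma> = {#}"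
  by (cases \<Gamma>) simp_all

lemma atomic_simps [simp]:
  "atomic {#}"
  "atomic (add_mset A \<Gamma>) \<longleftrightarrow> A \<in> range Var \<and> atomic \<Gamma>"
  "atomic (\<Gamma> + \<Delta>) \<longleftrightarrow> atomic \<Gamma> \<and> atomic \<Delta>"
  by (auto simp: atomic_def)

lemma atomic_replicate_Var [simp]: "atomic (replicate_mset n (Var p))"
  by (auto simp: atomic_def)

lemma atomic_repeat_mset: "atomic \<Gamma> \<Longrightarrow> atomic (repeat_mset n \<Gamma>)"
  by (induction n) simp_all

lemma vars_mset_simps [simp]:
  "vars_mset {#} = {}"
  "vars_mset (add_mset A \<Gamma>) = vars A \<union> vars_mset \<Gamma>"
  "vars_mset (\<Gamma> + \<Delta>) = vars_mset \<Gamma> \<union> vars_mset \<Delta>"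
  by (auto simp: vars_mset_def)

lemma vars_mset_replicate_Var [simp]:
  "vars_mset (replicate_mset n (Var p)) = (if n = 0 then {} else {p})"
  by (auto simp: vars_mset_def)

lemma vars_mset_repeat_mset: "n > 0 \<Longrightarrow> vars_mset (repeat_mset n \<Gamma>) = vars_mset \<Gamma>"
  by (induction n rule: nat_induct_non_zero) simp_all

lemma vars_hyp_simps [simp]:
  "vars_hyp {#} = {}"
  "vars_hyp (add_mset s G) = vars_seq s \<union> vars_hyp G"
  "vars_hyp (G + H) = vars_hyp G \<union> vars_hyp H"
  by (auto simp: vars_hyp_def vars_seq_def split: prod.splits)

lemma finite_vars_fm: "finite (vars A)"
  by (induction A) simp_all

lemma finite_vars_hyp: "finite (vars_hyp G)"
  by (auto simp: vars_hyp_def vars_mset_def finite_vars_fm)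

lemma weight_pos: "weight s > 0"
  by (simp add: weight_def)

text \<open>An atomic \<open>s'\<close> weighs 1, at most any power of 3, so the power bounds both
  cases. The factor 3 leaves room for two smaller components in place of \<open>s\<close>.\<close>

lemma weight_smaller:
  assumes "\<not> atomic_seq s" "seq_size s' < seq_size s"
  shows "3 * weight s' \<le> weight s"
proof -
  have "weight s' \<le> 3 ^ seq_size s'"
    by (simp add: weight_def)
  then have "3 * weight s' \<le> 3 ^ Suc (seq_size s')"
    by simp
  also have "\<dots> \<le> (3 :: nat) ^ seq_size s"
    using assms(2) by (intro power_increasing) auto
  finally show ?thesis
    using assms(1) by (simp add: weight_def)
qed

lemma search_order_weight:
  assumes "(\<Sum>s\<in>#G'. weight s) < (\<Sum>s\<in>#G. weight s)"
  shows "((q', G'), (q, G)) \<in> search_order"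
  using assms by (simp add: search_order_def)

lemma search_order_replace:
  assumes "\<not> atomic_seq s" "seq_size s' < seq_size s"
  shows "((q, G + {#s'#}), (q, G + {#s#})) \<in> search_order"
  using weight_smaller[OF assms] weight_pos[of s'] by (intro search_order_weight) simp

text \<open>Serves \<open>And_l\<close> and \<open>Or_r\<close>, whose premise splits one component
  into two: together these weigh at most two thirds of \<open>weight s\<close>.\<close>

lemma search_order_replace2:
  assumes "\<not> atomic_seq s" "seq_size s1 < seq_size s" "seq_size s2 < seq_size s"
  shows "((q, G + {#s1, s2#}), (q, G + {#s#})) \<in> search_order"
  using weight_smaller[OF assms(1,2)] weight_smaller[OF assms(1,3)] weight_pos[of s1]
  by (intro search_order_weight) simp

lemma search_order_EW: "((q, G + {#s#}), (q, G + {#s, s'#})) \<in> search_order"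
  using weight_pos[of s'] by (intro search_order_weight) simp

lemma search_order_M:
  assumes "\<Gamma>' \<noteq> {#} \<or> \<Delta>' \<noteq> {#}"
  shows "((q, G + {#\<Gamma> \<turnstile> \<Delta>#}), (q, G + {#\<Gamma> + \<Gamma>' \<turnstile> \<Delta> + \<Delta>'#})) \<in> search_order"
proof -
  let ?s = "\<Gamma> \<turnstile> \<Delta>" and ?t = "\<Gamma> + \<Gamma>' \<turnstile> \<Delta> + \<Delta>'"
  have size: "seq_size ?s < seq_size ?t"
    using assms by (auto simp: seq_size_def simp flip: mset_size_eq_0_iff)
  show ?thesis
  proof (cases "atomic_seq ?t")
    case False
    then show ?thesis
      using size by (rule search_order_replace)
  next
    case True
    then have weight: "weight ?s = weight ?t"
      by (simp add: weight_def atomic_seq_def)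
    have vars: "vars_seq ?s \<subseteq> vars_seq ?t"
      by (auto simp: vars_seq_def)
    have "card (vars_hyp (G + {#?s#}) - {q}) \<le> card (vars_hyp (G + {#?t#}) - {q})"
      using vars by (intro card_mono finite_Diff finite_vars_hyp) auto
    \<comment> \<open>With equal weights, the second and third measures may drop or tie; if both
      tie, the total size decides.\<close>
    then show ?thesis
      using weight vars size by (auto simp: search_order_def le_less)
  qed
qed

text \<open>Deleting the absent \<open>p\<close> from \<open>vars_hyp G\<close> changes nothing,
  while deleting \<open>q\<close> lowers the cardinality; weights ignore the focus.\<close>

lemma search_order_shift:
  assumes "q \<in> vars_hyp G" "p \<notin> vars_hyp G"
  shows "((q, G), (p, G)) \<in> search_order"
  using assms card_Diff1_less[OF finite_vars_hyp assms(1)] by (simp add: search_order_def)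

lemma search_order_S':
  assumes "atomic \<Gamma>1" "atomic \<Gamma>2" "atomic \<Delta>1" "atomic \<Delta>2" "n > 0" "m > 0"
    and "p \<notin> vars_mset \<Gamma>1 \<union> vars_mset \<Delta>1 \<union> vars_mset \<Gamma>2 \<union> vars_mset \<Delta>2"
    and "S = (\<Gamma>1 + replicate_mset n (Var p) \<turnstile> \<Delta>1) \<or> S = (\<Gamma>2 \<turnstile> \<Delta>2 + replicate_mset m (Var p))"
  shows "((p, G + {# repeat_mset m \<Gamma>1 + repeat_mset n \<Gamma>2 \<turnstile> repeat_mset m \<Delta>1 + repeat_mset n \<Delta>2, S #}),
      (p, G + {# \<Gamma>1 + replicate_mset n (Var p) \<turnstile> \<Delta>1, \<Gamma>2 \<turnstile> \<Delta>2 + replicate_mset m (Var p) #}))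
    \<in> search_order"
proof -
  let ?s = "repeat_mset m \<Gamma>1 + repeat_mset n \<Gamma>2 \<turnstile> repeat_mset m \<Delta>1 + repeat_mset n \<Delta>2"
  let ?s1 = "\<Gamma>1 + replicate_mset n (Var p) \<turnstile> \<Delta>1"
  let ?s2 = "\<Gamma>2 \<turnstile> \<Delta>2 + replicate_mset m (Var p)"
  have weight: "weight ?s = 1" "weight S = 1" "weight ?s1 = 1" "weight ?s2 = 1"
    using assms by (auto simp: weight_def atomic_seq_def atomic_repeat_mset)
  have vars: "vars_seq ?s \<union> vars_seq S \<subseteq> vars_seq ?s1 \<union> vars_seq ?s2"
    using assms(5,6,8) by (auto simp: vars_seq_def vars_mset_repeat_mset)
  \<comment> \<open>The contexts, hence their multiples, avoid \<open>p\<close>, so of the two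
    premise components only \<open>S\<close> counts; \<open>n > 0\<close> and \<open>m > 0\<close>
    make both components of the conclusion count.\<close>
  have focus: "p \<notin> vars_seq ?s" "p \<in> vars_seq S" "p \<in> vars_seq ?s1" "p \<in> vars_seq ?s2"
    using assms(5-8) by (auto simp: vars_seq_def vars_mset_repeat_mset)
  have "card (vars_hyp (G + {#?s, S#}) - {p}) \<le> card (vars_hyp (G + {#?s1, ?s2#}) - {p})"
    using vars by (intro card_mono finite_Diff finite_vars_hyp) auto
  then show ?thesis
    using weight focus by (auto simp: search_order_def le_less)
qed

lemma premise_of_search_order:
  assumes "premise_of H' H" "H' \<noteq> H"
  shows "(H', H) \<in> search_order"
proof -
  obtain Hs where "GAt Hs H" "H' \<in> set Hs"
    using assms(1) by (auto simp: premise_of_def)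
  then show ?thesis
    using assms(2)
  proof (induction rule: GAt.induct)
    case (EW q G \<Gamma> \<Delta> \<Gamma>' \<Delta>')
    then show ?case
      using search_order_EW[of q G "\<Gamma> \<turnstile> \<Delta>" "\<Gamma>' \<turnstile> \<Delta>'"] by simp
  next
    case (M q G \<Gamma>1 \<Delta>1 \<Gamma>2 \<Delta>2)
    \<comment> \<open>If the other half were empty, this premise would be the conclusion itself,
      contrary to \<open>H' \<noteq> H\<close>.\<close>
    then have "H' = (q, G + {#\<Gamma>1 \<turnstile> \<Delta>1#}) \<and> (\<Gamma>2 \<noteq> {#} \<or> \<Delta>2 \<noteq> {#})
        \<or> H' = (q, G + {#\<Gamma>2 \<turnstile> \<Delta>2#}) \<and> (\<Gamma>1 \<noteq> {#} \<or> \<Delta>1 \<noteq> {#})"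
      by auto
    \<comment> \<open>\<open>search_order_M\<close> keeps the left summand; commutativity adapts it
      to the second premise.\<close>
    then show ?case
      using search_order_M[of \<Gamma>2 \<Delta>2 q G \<Gamma>1 \<Delta>1] search_order_M[of \<Gamma>1 \<Delta>1 q G \<Gamma>2 \<Delta>2]
        add.commute[of \<Gamma>1 \<Gamma>2] add.commute[of \<Delta>1 \<Delta>2] by metis
  next
    case (shift q G p)
    then show ?case
      using search_order_shift by simp
  next
    case (S' \<Gamma>1 \<Gamma>2 \<Delta>1 \<Delta>2 n m p S G)
    then have "H' = (p, G + {# repeat_mset m \<Gamma>1 + repeat_mset n \<Gamma>2
        \<turnstile> repeat_mset m \<Delta>1 + repeat_mset n \<Delta>2, S #})"
      by simp
    then show ?case
      using search_order_S'[OF S'(1-8)] by simp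
  \<comment> \<open>Axioms have no premises. In a logical rule the principal formula is not a
    variable, so its component is non-atomic.\<close>
  qed (auto intro!: search_order_replace[simplified] search_order_replace2[simplified]
         simp: atomic_seq_def seq_size_def)
qed

(* Backward steps that return the conclusion unchanged are not counted. They arise only from M
   with an empty component: G | \<turnstile> and G | \<Gamma> \<turnstile> \<Delta> yield G | \<Gamma> \<turnstile> \<Delta>, whose second premise is the
   conclusion itself, so that without H (Suc k) \<noteq> H k a constant sequence would be infinite. *)
theorem mainTheorem8:
  fixes p :: 'v and G :: "'v hypersequent"
  shows "\<not> (\<exists>H :: nat \<Rightarrow> 'v fhypersequent.
            H 0 = (p, G) \<and> (\<forall>k. premise_of (H (Suc k)) (H k) \<and> H (Suc k) \<noteq> H k))"
proof
  assume "\<exists>H :: nat \<Rightarrow> 'v fhypersequent.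
    H 0 = (p, G) \<and> (\<forall>k. premise_of (H (Suc k)) (H k) \<and> H (Suc k) \<noteq> H k)"
  then obtain H :: "nat \<Rightarrow> 'v fhypersequent"
    where "\<forall>k. premise_of (H (Suc k)) (H k) \<and> H (Suc k) \<noteq> H k"
    by blast
  then have "\<forall>k. (H (Suc k), H k) \<in> search_order"
    by (blast intro: premise_of_search_order)
  moreover have "wf (search_order :: 'v fhypersequent rel)"
    by (simp add: search_order_def)
  ultimately show False
    by (simp add: wf_iff_no_infinite_down_chain) blast
qed

end
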